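(* Let $0<\alpha<1$. Then there exist a compact set $E\subset\mathbb R$, a Borel probability measure $\mu$ on $\mathbb R$ supported on $E$, and constants $0<c\le C<\infty$ such that $$|\hat\mu(\xi)|\le C|\xi|^{-\alpha/2}(\log|\xi|)^{1/2}\quad\text{for all }\xi\in\mathbb R,\ |\xi|\ge 2,$$ and $$c\,|I|^\alpha\le \mu(I)\le C\,|I|^\alpha$$ for all intervals $I\subset\mathbb R$ centered in $E$ with $|I|<1$.
   Context: For a finite Borel measure $\mu$ on $\mathbb R$, $\hat\mu(\xi)=\int_{\mathbb R}e^{-2\pi i\xi x}\,d\mu(x)$. A Borel probability measure $\mu$ is said to be supported on a set $E$ if $\mu(E)=1$. For an interval $I$, $|I|$ denotes its length; $I$ is centered in $E$ if its midpoint belongs to $E$. $\log$ is the natural logarithm. The constants $c,C$ do not depend on $\xi$ or $I$. *)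

theory Defs
  imports "HOL-Probability.Probability"
begin

definition fourier_measure :: "real measure \<Rightarrow> real \<Rightarrow> complex" where
  "fourier_measure \<mu> \<xi> = (\<integral>x. exp (- (2 * complex_of_real pi * \<i> * complex_of_real \<xi> * complex_of_real x)) \<partial>\<mu>)"

text \<open>The following two notions are meaningful for nonempty bounded intervals of any kind
  (open, closed, half-open), including one-point intervals.\<close>

definition interval_length :: "real set \<Rightarrow> real" where
  "interval_length I = Sup I - Inf I"

definition centered_in :: "real set \<Rightarrow> real set \<Rightarrow> bool" where
  "centered_in I E \<longleftrightarrow> (Inf I + Sup I) / 2 \<in> E"

end

theory Submission
  imports Defs
begin

text \<open>The measure lives on a dyadic Cantor set. Generation \<open>n\<close> has \<open>M n \<approx> 2\<^bsup>\<alpha>n\<^esup>\<close> dyadic intervals of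
  length \<open>2\<^sup>-\<^sup>n\<close>, all of mass \<open>1 / M n\<close>; passing to the next generation, either every interval
  keeps both halves, or every interval keeps exactly one, according to a sign. This gives the
  \<open>\<alpha>\<close>-regularity without logarithmic loss. Let \<open>F n\<close> be the Fourier transform of the measure spread
  uniformly over generation \<open>n\<close>. In a sign step \<open>F (n+1) - F n\<close> is a signed exponential sum over
  the intervals, divided by \<open>M n\<close>, times a kernel of size \<open>min 1 (2\<^sup>n / \<bar>\<xi>\<bar>)\<close>. Choosing the
  signs one by one so that a sum of hyperbolic cosines over a grid of frequencies stays small
  (Hoeffding's inequality, derandomised) makes the sum \<open>O(\<surd>(n M n))\<close> at all frequencies. Summing
  \<open>\<surd>n 2\<^bsup>-\<alpha>n/2\<^esup> min 1 (2\<^sup>n / \<bar>\<xi>\<bar>)\<close> over \<open>n\<close> gives the decay, as \<open>\<alpha>/2 < 1\<close>.\<close>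

subsection \<open>Signs making an exponential sum small\<close>

lemma nat_floor_bounds:
  fixes x :: real
  assumes "0 \<le> x"
  shows "real (nat \<lfloor>x\<rfloor>) \<le> x" and "x < real (nat \<lfloor>x\<rfloor>) + 1"
proof -
  have "real (nat \<lfloor>x\<rfloor>) = of_int \<lfloor>x\<rfloor>"
    using assms by (simp add: of_nat_nat)
  then show "real (nat \<lfloor>x\<rfloor>) \<le> x" "x < real (nat \<lfloor>x\<rfloor>) + 1"
    by linarith+
qed

text \<open>\<open>cosh x\<close> is the moment generating function of a fair sign, so this is
  Hoeffding's lemma: \<open>Hoeffdings_lemma_aux\<close> is applied with probability
  \<open>1/2\<close> and parameter \<open>2 * \<bar>x\<bar>\<close>.\<close>

lemma cosh_le_exp_half_square:
  fixes x :: real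
  shows "cosh x \<le> exp (x\<^sup>2 / 2)"
proof -
  have "ln (cosh \<bar>x\<bar>) = - (2 * \<bar>x\<bar>) * (1/2) + ln (1 + 1/2 * (exp (2 * \<bar>x\<bar>) - 1))"
  proof -
    have "cosh \<bar>x\<bar> = exp (- \<bar>x\<bar>) * (1 + 1/2 * (exp (2 * \<bar>x\<bar>) - 1))"
      unfolding cosh_field_def by (simp add: field_simps flip: exp_add)
    moreover have "0 < 1 + 1/2 * (exp (2 * \<bar>x\<bar>) - 1)"
      using exp_gt_zero[of "2 * \<bar>x\<bar>"] by (simp add: field_simps add_pos_pos)
    ultimately show ?thesis
      by (simp only: ln_mult_pos exp_gt_zero ln_exp)
  qed
  also have "\<dots> \<le> (2 * \<bar>x\<bar>)\<^sup>2 / 8"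
    by (rule Hoeffdings_lemma_aux) auto
  finally have "ln (cosh x) \<le> x\<^sup>2 / 2"
    by (simp add: power_mult_distrib)
  thus ?thesis
    by (metis cosh_real_pos exp_le_cancel_iff exp_ln)
qed

text \<open>Conditional expectations: averaging over the next sign multiplies each summand by
  \<open>cosh (\<beta> * f x m)\<close>, at most \<open>exp (\<beta>\<^sup>2 / 2)\<close>, so one of
  the two signs does no worse than that. Being even, \<open>cosh\<close> controls both tails at
  once.\<close>

lemma exists_signs_cosh_sum_le:
  fixes f :: "'g \<Rightarrow> nat \<Rightarrow> real"
  assumes "finite G" and "\<And>x i. x \<in> G \<Longrightarrow> i < m \<Longrightarrow> \<bar>f x i\<bar> \<le> 1"
  shows "\<exists>\<epsilon>. (\<forall>i. \<epsilon> i \<in> {1, -1}) \<and>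
    (\<Sum>x\<in>G. cosh (\<beta> * (\<Sum>i<m. \<epsilon> i * f x i))) \<le> real (card G) * exp (real m * \<beta>\<^sup>2 / 2)"
  using assms(2)
proof (induction m)
  case 0
  show ?case by (rule exI[of _ "\<lambda>_. 1"]) simp
next
  case (Suc m)
  then obtain \<epsilon> where \<epsilon>: "\<And>i. \<epsilon> i \<in> {1, -1}"
    and le: "(\<Sum>x\<in>G. cosh (\<beta> * (\<Sum>i<m. \<epsilon> i * f x i))) \<le> real (card G) * exp (real m * \<beta>\<^sup>2 / 2)"
    by fastforce
  define S where "S x = \<beta> * (\<Sum>i<m. \<epsilon> i * f x i)" for x
  define T where "T s = (\<Sum>x\<in>G. cosh (S x + \<beta> * (s * f x m)))" for s
  \<comment> \<open>The \<open>sinh\<close> terms of the two addition formulas cancel.\<close>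
  have "T 1 + T (-1) = (\<Sum>x\<in>G. 2 * cosh (S x) * cosh (\<beta> * f x m))"
    unfolding T_def sum.distrib[symmetric] by (simp add: cosh_add cosh_diff mult.assoc)
  also have "\<dots> \<le> (\<Sum>x\<in>G. 2 * cosh (S x) * exp (\<beta>\<^sup>2 / 2))"
  proof (intro sum_mono mult_left_mono)
    fix x assume "x \<in> G"
    have "(f x m)\<^sup>2 \<le> 1"
      using Suc.prems[OF \<open>x \<in> G\<close>, of m] abs_square_le_1 by blast
    then have "(\<beta> * f x m)\<^sup>2 \<le> \<beta>\<^sup>2"
      by (simp add: power_mult_distrib mult_left_le)
    then show "cosh (\<beta> * f x m) \<le> exp (\<beta>\<^sup>2 / 2)"
      by (intro order_trans[OF cosh_le_exp_half_square]) simp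
  qed simp
  also have "\<dots> = 2 * exp (\<beta>\<^sup>2 / 2) * (\<Sum>x\<in>G. cosh (S x))"
    by (simp add: sum_distrib_left sum_distrib_right mult_ac)
  also have "\<dots> \<le> 2 * exp (\<beta>\<^sup>2 / 2) * (real (card G) * exp (real m * \<beta>\<^sup>2 / 2))"
    using le by (intro mult_left_mono) (simp_all add: S_def)
  also have "\<dots> = 2 * (real (card G) * exp (real (Suc m) * \<beta>\<^sup>2 / 2))"
    by (simp add: algebra_simps add_divide_distrib exp_add)
  finally obtain s where s: "s \<in> {1, -1}" "T s \<le> real (card G) * exp (real (Suc m) * \<beta>\<^sup>2 / 2)"
    by (metis insertCI add_mono_thms_linordered_field(5) mult_2 not_le)
  have "(\<Sum>i<Suc m. (\<epsilon>(m := s)) i * f x i) = (\<Sum>i<m. \<epsilon> i * f x i) + s * f x m" for x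
    by simp
  then have "(\<Sum>x\<in>G. cosh (\<beta> * (\<Sum>i<Suc m. (\<epsilon>(m := s)) i * f x i))) = T s"
    unfolding T_def S_def by (simp add: distrib_left)
  with s \<epsilon> show ?case
    by (intro exI[of _ "\<epsilon>(m := s)"]) auto
qed

text \<open>Each summand is below the whole sum of hyperbolic cosines; taking logarithms gives a
  bound at every point of \<open>G\<close>. The 2 in \<open>2 * real (card G)\<close> comes from
  \<open>exp t \<le> 2 * cosh t\<close>.\<close>

lemma exists_signs_sum_le:
  fixes f :: "'g \<Rightarrow> nat \<Rightarrow> real"
  assumes "finite G" and "\<And>x i. x \<in> G \<Longrightarrow> i < m \<Longrightarrow> \<bar>f x i\<bar> \<le> 1"
    and "0 < m" and "0 < L" and "ln (2 * real (card G)) \<le> L"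
  shows "\<exists>\<epsilon>. (\<forall>i. \<epsilon> i \<in> {1, -1}) \<and> (\<forall>x\<in>G. \<bar>\<Sum>i<m. \<epsilon> i * f x i\<bar> \<le> 2 * sqrt (real m * L))"
proof -
  \<comment> \<open>The bound to be minimised is \<open>L / \<beta> + m * \<beta> / 2\<close>. This
    choice makes it 3/2 times \<open>sqrt (m * L)\<close>, rounded up to 2.\<close>
  define \<beta> where "\<beta> = sqrt (L / real m)"
  obtain \<epsilon> where \<epsilon>: "\<And>i. \<epsilon> i \<in> {1, -1}"
    and le: "(\<Sum>x\<in>G. cosh (\<beta> * (\<Sum>i<m. \<epsilon> i * f x i))) \<le> real (card G) * exp (real m * \<beta>\<^sup>2 / 2)"
    using exists_signs_cosh_sum_le[where f = f and \<beta> = \<beta>, OF assms(1,2)] by blast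
  have "\<beta> > 0" and m\<beta>: "real m * \<beta>\<^sup>2 = L"
    using assms by (simp_all add: \<beta>_def)
  have \<beta>L: "\<beta> * sqrt (real m * L) = L"
    using assms by (simp add: \<beta>_def flip: real_sqrt_mult power2_eq_square)
  have "\<bar>\<Sum>i<m. \<epsilon> i * f x i\<bar> \<le> 2 * sqrt (real m * L)" if "x \<in> G" for x
  proof -
    let ?S = "\<Sum>i<m. \<epsilon> i * f x i"
    have card: "0 < card G"
      using that assms(1) card_gt_0_iff by blast
    have "exp (\<beta> * \<bar>?S\<bar>) / 2 \<le> cosh (\<beta> * \<bar>?S\<bar>)"
      unfolding cosh_field_def by simp
    also have "\<dots> = cosh (\<beta> * ?S)"
      using \<open>\<beta> > 0\<close> cosh_real_abs[of "\<beta> * ?S"] by (simp add: abs_mult)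
    also have "\<dots> \<le> (\<Sum>x\<in>G. cosh (\<beta> * (\<Sum>i<m. \<epsilon> i * f x i)))"
      using that assms(1) by (intro member_le_sum) auto
    also note le
    finally have "exp (\<beta> * \<bar>?S\<bar>) \<le> 2 * real (card G) * exp (real m * \<beta>\<^sup>2 / 2)"
      by simp
    then have "\<beta> * \<bar>?S\<bar> \<le> ln (2 * real (card G) * exp (real m * \<beta>\<^sup>2 / 2))"
      using card by (subst ln_ge_iff) auto
    also have "\<dots> = ln (2 * real (card G)) + L / 2"
      using card m\<beta> by (simp add: ln_mult_pos)
    also have "\<dots> \<le> 2 * L"
      using assms by simp
    also have "\<dots> = \<beta> * (2 * sqrt (real m * L))"
      using \<beta>L by simp
    finally show ?thesis
      using \<open>\<beta> > 0\<close> by simp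
  qed
  with \<epsilon> show ?thesis by blast
qed

section \<open>The additive character and its Lipschitz bound\<close>

definition fexp :: "real \<Rightarrow> complex" where
  "fexp x = cis (- (2 * pi * x))"

lemma norm_fexp [simp]: "cmod (fexp x) = 1"
  by (simp add: fexp_def)

lemma fexp_0 [simp]: "fexp 0 = 1"
  by (simp add: fexp_def)

lemma fexp_add: "fexp (x + y) = fexp x * fexp y"
  by (simp add: fexp_def cis_mult ring_distribs)

lemma fexp_Ints: "x \<in> \<int> \<Longrightarrow> fexp x = 1"
  using cis_multiple_2pi[of "- x"] by (simp add: fexp_def)

lemma norm_fexp_minus_one_le: "cmod (fexp x - 1) \<le> 2 * pi * \<bar>x\<bar>"
proof -
  have "cmod (fexp x - 1) = 2 * \<bar>sin (- (2 * pi * x) / 2)\<bar>"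
    unfolding fexp_def cis_conv_exp by (rule dist_exp_i_1)
  also have "\<dots> \<le> 2 * \<bar>- (2 * pi * x) / 2\<bar>"
    using abs_sin_x_le_abs_x by (intro mult_left_mono) auto
  finally show ?thesis
    by (simp add: abs_mult)
qed

lemma norm_fexp_diff_le: "cmod (fexp x - fexp y) \<le> 2 * pi * \<bar>x - y\<bar>"
proof -
  have "fexp x - fexp y = fexp y * (fexp (x - y) - 1)"
    using fexp_add[of y "x - y"] by (simp add: algebra_simps)
  then show ?thesis
    using norm_fexp_minus_one_le[of "x - y"] by (simp add: norm_mult)
qed

text \<open>The sums are \<open>2\<^sup>n\<close>-periodic in \<open>\<xi>\<close> and \<open>2\<pi>m\<close>-Lipschitz, so the \<open>4\<^sup>n\<close> frequencies
  \<open>k / 2\<^sup>n\<close> control all real ones.\<close>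

lemma exists_signs_exponential_sum_le:
  fixes a :: "nat \<Rightarrow> nat"
  assumes a: "\<And>k. k < m \<Longrightarrow> a k < 2 ^ n" and m: "0 < m" "m \<le> 2 ^ n"
  shows "\<exists>\<epsilon>. (\<forall>i. \<epsilon> i \<in> {1, -1 :: real}) \<and>
    (\<forall>\<xi>. cmod (\<Sum>k<m. of_real (\<epsilon> k) * fexp (\<xi> * real (a k) / 2 ^ n)) \<le> 16 * sqrt (real m * real (Suc n)))"
proof -
  define u where "u j k = fexp (real j / 2 ^ n * real (a k) / 2 ^ n)" for j k :: nat
  \<comment> \<open>The sign lemma is about real functions, so the real and imaginary parts at a
    grid frequency count as two points of \<open>G\<close>, told apart by the Boolean.\<close>
  define f where "f x k = (if snd x then Re (u (fst x) k) else Im (u (fst x) k))" for x :: "nat \<times> bool" and k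
  define G where "G = {..<4 ^ n :: nat} \<times> (UNIV :: bool set)"
  have f1: "\<bar>f x k\<bar> \<le> 1" for x k
    using abs_Re_le_cmod[of "u (fst x) k"] abs_Im_le_cmod[of "u (fst x) k"]
    by (simp add: f_def u_def)
  have "2 * real (card G) = 4 ^ Suc n"
    by (simp add: G_def)
  also have "ln \<dots> = real (Suc n) * ln 4"
    by (rule ln_realpow)
  also have "\<dots> \<le> real (Suc n) * 2"
    using ln_le_minus_one[of "2 :: real"] ln_realpow[of 2 2] by (intro mult_left_mono) auto
  finally have card: "ln (2 * real (card G)) \<le> real (Suc n) * 2" .
  have "finite G"
    by (simp add: G_def)
  have "0 < real (Suc n) * 2"
    by simp
  from exists_signs_sum_le[where f = f, OF \<open>finite G\<close> f1 m(1) this card]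
  obtain \<epsilon> where \<epsilon>: "\<And>i. \<epsilon> i \<in> {1, -1 :: real}"
    and le: "\<And>x. x \<in> G \<Longrightarrow> \<bar>\<Sum>k<m. \<epsilon> k * f x k\<bar> \<le> 2 * sqrt (real m * (real (Suc n) * 2))"
    by blast
  \<comment> \<open>Since \<open>1 \<le> s\<close>, the additive Lipschitz error can be absorbed
    into a multiple of \<open>s\<close>.\<close>
  define s where "s = sqrt (real m * real (Suc n))"
  have s1: "1 \<le> s"
    unfolding s_def using m
    by (simp only: real_sqrt_ge_1_iff) (metis One_nat_def Suc_leI mult_le_mono nat_mult_1 of_nat_1 of_nat_le_iff of_nat_mult zero_less_Suc)
  have le': "\<bar>\<Sum>k<m. \<epsilon> k * f x k\<bar> \<le> 3 * s" if "x \<in> G" for x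
  proof -
    have "sqrt (real m * (real (Suc n) * 2)) = s * sqrt 2"
      unfolding s_def real_sqrt_mult[symmetric] by (simp add: mult_ac)
    also have "sqrt 2 \<le> (3/2 :: real)"
      by (intro real_le_lsqrt) (auto simp: power2_eq_square)
    finally show ?thesis
      using le[OF that] s1 by (simp add: mult_left_mono)
  qed
  define S where "S \<xi> = (\<Sum>k<m. of_real (\<epsilon> k) * fexp (\<xi> * real (a k) / 2 ^ n))" for \<xi>
  have grid: "cmod (S (real j / 2 ^ n)) \<le> 6 * s" if "j < 4 ^ n" for j
  proof -
    have "Re (S (real j / 2 ^ n)) = (\<Sum>k<m. \<epsilon> k * f (j, True) k)"
      by (simp add: S_def f_def u_def)
    moreover have "Im (S (real j / 2 ^ n)) = (\<Sum>k<m. \<epsilon> k * f (j, False) k)"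
      by (simp add: S_def f_def u_def)
    ultimately show ?thesis
      using cmod_le[of "S (real j / 2 ^ n)"] le'[of "(j, True)"] le'[of "(j, False)"] that
      by (simp add: G_def)
  qed
  \<comment> \<open>The grid contributes \<open>6 * s\<close> and the distance to the grid at most
    8, hence \<open>8 * s\<close>; 16 leaves some room.\<close>
  have "cmod (S \<xi>) \<le> 16 * s" for \<xi>
  proof -
    define p where "p = \<lfloor>\<xi> / 2 ^ n\<rfloor>"
    define \<eta> where "\<eta> = \<xi> - 2 ^ n * of_int p"
    have "of_int p \<le> \<xi> / 2 ^ n" "\<xi> / 2 ^ n < of_int p + 1"
      unfolding p_def by linarith+
    then have \<eta>: "0 \<le> \<eta>" "\<eta> < 2 ^ n"
      unfolding \<eta>_def by (simp_all add: field_simps)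
    have "S \<xi> = S \<eta>"
      unfolding S_def
    proof (intro sum.cong refl arg_cong2[where f = "(*)"])
      fix k
      have "\<xi> * real (a k) / 2 ^ n = \<eta> * real (a k) / 2 ^ n + of_int (p * int (a k))"
        unfolding \<eta>_def by (simp add: field_simps)
      then show "fexp (\<xi> * real (a k) / 2 ^ n) = fexp (\<eta> * real (a k) / 2 ^ n)"
        by (simp only: fexp_add fexp_Ints Ints_of_int mult_1_right)
    qed
    define j where "j = nat \<lfloor>\<eta> * 2 ^ n\<rfloor>"
    have j: "real j \<le> \<eta> * 2 ^ n" "\<eta> * 2 ^ n < real j + 1"
      unfolding j_def using nat_floor_bounds[of "\<eta> * 2 ^ n"] \<eta> by simp_all
    have "\<eta> * 2 ^ n < 2 ^ n * 2 ^ n"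
      using \<eta> by (intro mult_strict_right_mono) auto
    then have "\<eta> * 2 ^ n < 4 ^ n"
      by (simp flip: power_mult_distrib)
    with j(1) have "real j < 4 ^ n"
      by (rule le_less_trans)
    then have "j < 4 ^ n"
      by (metis of_nat_less_numeral_power_cancel_iff)
    have "cmod (S \<eta> - S (real j / 2 ^ n))
        \<le> (\<Sum>k<m. cmod (of_real (\<epsilon> k) * fexp (\<eta> * real (a k) / 2 ^ n)
             - of_real (\<epsilon> k) * fexp (real j / 2 ^ n * real (a k) / 2 ^ n)))"
      unfolding S_def sum_subtractf[symmetric] by (rule norm_sum)
    also have "\<dots> \<le> (\<Sum>k<m. 2 * pi / 2 ^ n)"
    proof (intro sum_mono)
      fix k assume "k \<in> {..<m}"
      have "cmod (of_real (\<epsilon> k) * fexp (\<eta> * real (a k) / 2 ^ n)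
             - of_real (\<epsilon> k) * fexp (real j / 2 ^ n * real (a k) / 2 ^ n))
          = cmod (fexp (\<eta> * real (a k) / 2 ^ n) - fexp (real j / 2 ^ n * real (a k) / 2 ^ n))"
        using \<epsilon>[of k] by (auto simp: norm_minus_commute)
      also have "\<dots> \<le> 2 * pi * \<bar>\<eta> * real (a k) / 2 ^ n - real j / 2 ^ n * real (a k) / 2 ^ n\<bar>"
        by (rule norm_fexp_diff_le)
      also have "\<bar>\<eta> * real (a k) / 2 ^ n - real j / 2 ^ n * real (a k) / 2 ^ n\<bar>
          = \<bar>(\<eta> * 2 ^ n - real j) / 2 ^ n * (real (a k) / 2 ^ n)\<bar>"
        by (rule arg_cong[of _ _ abs]) (simp add: field_simps)
      also have "\<dots> = (\<eta> * 2 ^ n - real j) / 2 ^ n * (real (a k) / 2 ^ n)"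
        using j by (intro abs_of_nonneg) simp
      also have "\<dots> \<le> 1 / 2 ^ n * 1"
      proof (intro mult_mono divide_right_mono)
        have "real (a k) < 2 ^ n"
          using a \<open>k \<in> {..<m}\<close> by (metis lessThan_iff of_nat_less_numeral_power_cancel_iff)
        then show "real (a k) / 2 ^ n \<le> 1" by simp
      qed (use j in auto)
      finally show "cmod (of_real (\<epsilon> k) * fexp (\<eta> * real (a k) / 2 ^ n)
             - of_real (\<epsilon> k) * fexp (real j / 2 ^ n * real (a k) / 2 ^ n)) \<le> 2 * pi / 2 ^ n"
        by simp
    qed
    also have "\<dots> = 2 * pi * (real m / 2 ^ n)"
      by simp
    also have "\<dots> \<le> 2 * 4 * 1"
      using m pi_less_4 by (intro mult_mono) (auto simp: of_nat_le_numeral_power_cancel_iff)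
    finally have "cmod (S \<eta> - S (real j / 2 ^ n)) \<le> 8 * s"
      using s1 by simp
    then show ?thesis
      using grid[OF \<open>j < 4 ^ n\<close>] norm_triangle_sub[of "S \<eta>" "S (real j / 2 ^ n)"] s1 \<open>S \<xi> = S \<eta>\<close>
      by simp
  qed
  with \<epsilon> show ?thesis
    unfolding S_def s_def by blast
qed

subsection \<open>The kernel and the sum over generations\<close>

text \<open>The Fourier transform of the uniform distribution on \<open>[0, 1]\<close>, except for the junk value
  \<open>0\<close> at \<open>0\<close>.\<close>

definition unif_ft :: "real \<Rightarrow> complex" where
  "unif_ft u = (1 - fexp u) / (2 * of_real pi * \<i> * of_real u)"

text \<open>The uniform distribution on the unit interval is the average of those on its two halves.
  This makes refinement without selection leave the transform unchanged. At 0 both sides are the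
  junk value.\<close>

lemma unif_ft_half: "unif_ft (u / 2) * (1 + fexp (u / 2)) / 2 = unif_ft u"
proof (cases "u = 0")
  case False
  have "fexp u = fexp (u / 2) * fexp (u / 2)"
    using fexp_add[of "u / 2" "u / 2"] by simp
  then show ?thesis
    using False by (simp add: unif_ft_def field_simps)
qed (simp add: unif_ft_def)

lemma norm_unif_ft: "cmod (unif_ft u) = cmod (fexp u - 1) / (2 * pi * \<bar>u\<bar>)"
  by (simp add: unif_ft_def norm_divide norm_mult norm_minus_commute)

lemma norm_unif_ft_le_one: "cmod (unif_ft u) \<le> 1"
  using norm_fexp_minus_one_le[of u] by (cases "u = 0") (simp_all add: norm_unif_ft)

lemma norm_unif_ft_le_inverse: "cmod (unif_ft u) \<le> 1 / \<bar>u\<bar>"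
proof (cases "u = 0")
  case False
  have "cmod (unif_ft u) \<le> 2 / (2 * pi * \<bar>u\<bar>)"
    unfolding norm_unif_ft using norm_triangle_ineq4[of "fexp u" 1] by (intro divide_right_mono) auto
  also have "\<dots> \<le> 1 / \<bar>u\<bar>"
    using False pi_ge_two by (simp add: field_simps)
  finally show ?thesis .
qed (simp add: norm_unif_ft)

text \<open>Up to a constant, \<open>unif_ft\<close> is the difference quotient of the exponential
  at 0. The limit is over nonzero arguments, so the junk value is not seen.\<close>

lemma unif_ft_tendsto_one: "(unif_ft \<longlongrightarrow> 1) (at 0)"
proof -
  let ?c = "- (2 * of_real pi * \<i>) :: complex"
  have "((\<lambda>z. exp (?c * z)) has_field_derivative ?c) (at 0)"
    by (auto intro!: derivative_eq_intros)
  then have "((\<lambda>z. (exp (?c * z) - 1) / z) \<longlongrightarrow> ?c) (at 0)"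
    by (simp add: has_field_derivative_iff)
  moreover have "filterlim (complex_of_real) (at 0) (at 0)"
    unfolding filterlim_at by (auto intro!: tendsto_eq_intros simp: eventually_at_filter)
  ultimately have "((\<lambda>x. (exp (?c * of_real x) - 1) / of_real x) \<longlongrightarrow> ?c) (at 0)"
    by (rule filterlim_compose)
  then have "((\<lambda>x. (exp (?c * of_real x) - 1) / of_real x / ?c) \<longlongrightarrow> ?c / ?c) (at 0)"
    by (intro tendsto_divide tendsto_const) auto
  moreover have "(exp (?c * of_real x) - 1) / of_real x / ?c = unif_ft x" for x
  proof -
    have "fexp x = exp (?c * of_real x)"
      unfolding fexp_def cis_conv_exp by (rule arg_cong[of _ _ exp]) simp
    moreover have "(w - 1) / y / (- d) = (1 - w) / (d * y)" for w y d :: complex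
      by (simp add: minus_divide_left mult.commute)
    ultimately show ?thesis
      by (simp only: unif_ft_def)
  qed
  ultimately show ?thesis
    by simp
qed

text \<open>For \<open>j \<le> k\<close> the minimum is at most \<open>2\<^bsup>j+1-k\<^esup>\<close> and the terms grow geometrically because
  \<open>2 q > 1\<close>; for \<open>j > k\<close> they decay like \<open>q\<^sup>j\<close>.\<close>

lemma sum_sqrt_geometric_min_le:
  fixes q :: real
  assumes q: "1/2 < q" "q < 1"
  shows "\<exists>D. \<forall>n k x. 2 ^ k \<le> x \<longrightarrow>
    (\<Sum>j<n. sqrt (real (Suc j)) * q ^ j * min 1 (2 ^ Suc j / x)) \<le> D * sqrt (real (Suc k)) * q ^ k"
proof -
  \<comment> \<open>The sum of the differentiated geometric series; it bounds the tail beyond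
    \<open>k\<close>.\<close>
  define T where "T = 1 / (1 - q)\<^sup>2"
  have sums: "(\<lambda>n. real (Suc n) * q ^ n) sums T"
    unfolding T_def using q geometric_deriv_sums[of q] by simp
  define D where "D = 4 * q / (2 * q - 1) + T"
  have "(\<Sum>j<n. sqrt (real (Suc j)) * q ^ j * min 1 (2 ^ Suc j / x)) \<le> D * sqrt (real (Suc k)) * q ^ k"
    if x: "2 ^ k \<le> x" for n k x
  proof -
    let ?g = "\<lambda>j. sqrt (real (Suc j)) * q ^ j * min 1 (2 ^ Suc j / x)"
    have "x > 0"
      using x by (rule less_le_trans[rotated]) simp
    then have nn: "0 \<le> ?g j" for j
      using q by simp
    have low: "(\<Sum>j<Suc k. ?g j) \<le> 4 * q / (2 * q - 1) * (sqrt (real (Suc k)) * q ^ k)"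
    proof -
      have "(\<Sum>j<Suc k. ?g j) \<le> (\<Sum>j<Suc k. sqrt (real (Suc k)) * (2 / 2 ^ k) * (2 * q) ^ j)"
      proof (rule sum_mono)
        fix j assume "j \<in> {..<Suc k}"
        have "min 1 (2 ^ Suc j / x) \<le> 2 ^ Suc j / 2 ^ k"
          using x \<open>x > 0\<close> by (intro min.coboundedI2 divide_left_mono) auto
        then have "?g j \<le> sqrt (real (Suc k)) * q ^ j * (2 ^ Suc j / 2 ^ k)"
          using q \<open>j \<in> _\<close> \<open>x > 0\<close> by (intro mult_mono) auto
        then show "?g j \<le> sqrt (real (Suc k)) * (2 / 2 ^ k) * (2 * q) ^ j"
          by (simp add: power_mult_distrib mult_ac)
      qed
      also have "\<dots> = sqrt (real (Suc k)) * (2 / 2 ^ k) * (((2 * q) ^ Suc k - 1) / (2 * q - 1))"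
        unfolding sum_distrib_left[symmetric] using q by (subst geometric_sum) auto
      also have "\<dots> \<le> sqrt (real (Suc k)) * (2 / 2 ^ k) * ((2 * q) ^ Suc k / (2 * q - 1))"
        using q by (intro mult_left_mono divide_right_mono) auto
      also have "\<dots> = 4 * q / (2 * q - 1) * (sqrt (real (Suc k)) * q ^ k)"
        by (simp add: power_mult_distrib)
      finally show ?thesis .
    qed
    have high: "(\<Sum>i<n. ?g (i + Suc k)) \<le> T * (sqrt (real (Suc k)) * q ^ k)"
    proof -
      have "(\<Sum>i<n. ?g (i + Suc k)) \<le> (\<Sum>i<n. (sqrt (real (Suc k)) * q ^ k) * (real (Suc (Suc i)) * q ^ Suc i))"
      proof (rule sum_mono)
        fix i
        \<comment> \<open>A crude separation of \<open>i\<close> from \<open>k\<close>: the linear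
          weight left on \<open>i\<close> is harmless against geometric decay.\<close>
        have "real (Suc (i + Suc k)) \<le> real (Suc k) * (real (Suc (Suc i)))\<^sup>2"
          unfolding of_nat_mult[symmetric] of_nat_power[symmetric] of_nat_le_iff
          by (simp add: algebra_simps power2_eq_square)
        then have "sqrt (real (Suc (i + Suc k))) \<le> sqrt (real (Suc k)) * real (Suc (Suc i))"
          by (metis real_sqrt_le_mono real_sqrt_mult real_sqrt_unique of_nat_0_le_iff)
        then have "?g (i + Suc k) \<le> (sqrt (real (Suc k)) * real (Suc (Suc i))) * q ^ (i + Suc k) * 1"
          using q \<open>x > 0\<close> by (intro mult_mono) auto
        then show "?g (i + Suc k) \<le> (sqrt (real (Suc k)) * q ^ k) * (real (Suc (Suc i)) * q ^ Suc i)"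
          by (simp add: power_add mult_ac)
      qed
      also have "\<dots> = (sqrt (real (Suc k)) * q ^ k) * (\<Sum>i<n. (real (Suc (Suc i)) * q ^ Suc i))"
        by (rule sum_distrib_left[symmetric])
      also have "(\<Sum>i<n. (real (Suc (Suc i)) * q ^ Suc i)) \<le> (\<Sum>i<Suc n. (real (Suc i) * q ^ i))"
        unfolding sum.lessThan_Suc_shift by simp
      also have "\<dots> \<le> T"
        using q unfolding sums_unique[OF sums]
        by (intro sum_le_suminf sums_summable[OF sums]) auto
      finally show ?thesis
        using q by (simp add: mult_left_mono mult.commute)
    qed
    \<comment> \<open>Padding with nonnegative terms lets the sum be split at \<open>Suc k\<close>
      whatever \<open>n\<close> is.\<close>
    have "(\<Sum>j<n. ?g j) \<le> (\<Sum>j<n + Suc k. ?g j)"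
      using nn by (intro sum_mono2) auto
    also have "\<dots> = (\<Sum>j<Suc k. ?g j) + (\<Sum>i<n. ?g (i + Suc k))"
      by (induction n) simp_all
    also have "\<dots> \<le> D * sqrt (real (Suc k)) * q ^ k"
      using low high by (simp only: D_def distrib_right mult.assoc)
    finally show ?thesis .
  qed
  then show ?thesis by blast
qed

subsection \<open>The dyadic construction\<close>

text \<open>A greedy rule: doubling whenever the target permits keeps the count within a factor 2
  below \<open>2 powr (\<alpha> * real n)\<close>.\<close>

primrec cells :: "real \<Rightarrow> nat \<Rightarrow> nat" where
  "cells \<alpha> 0 = 1"
| "cells \<alpha> (Suc n) =
     (if 2 * real (cells \<alpha> n) \<le> 2 powr (\<alpha> * real (Suc n)) then 2 * cells \<alpha> n else cells \<alpha> n)"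

text \<open>The target grows by a factor strictly between 1 and 2. Without doubling the upper bound
  survives and the failed test is the lower bound; with doubling the test is the upper bound and the
  lower bound survives.\<close>

lemma cells_bounds:
  assumes "0 < \<alpha>" "\<alpha> < 1"
  shows "real (cells \<alpha> n) \<le> 2 powr (\<alpha> * real n)" and "2 powr (\<alpha> * real n) < 2 * real (cells \<alpha> n)"
proof (induction n)
  case (Suc n)
  have "2 powr (\<alpha> * real (Suc n)) = 2 powr (\<alpha> * real n) * 2 powr \<alpha>"
    by (simp add: distrib_left add.commute flip: powr_add)
  moreover have "1 < (2::real) powr \<alpha>" "2 powr \<alpha> < (2 :: real) powr 1"
    using assms powr_less_mono[of \<alpha> 1 2] by auto
  then have "2 powr (\<alpha> * real n) \<le> 2 powr (\<alpha> * real n) * 2 powr \<alpha>"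
    "2 powr (\<alpha> * real n) * 2 powr \<alpha> < 2 powr (\<alpha> * real n) * 2"
    by auto
  ultimately show "real (cells \<alpha> (Suc n)) \<le> 2 powr (\<alpha> * real (Suc n))"
    "2 powr (\<alpha> * real (Suc n)) < 2 * real (cells \<alpha> (Suc n))"
    using Suc by (simp_all only: cells.simps of_nat_mult split: if_split) linarith+
qed auto

lemma cells_le_power:
  assumes "0 < \<alpha>" "\<alpha> < 1"
  shows "cells \<alpha> n \<le> 2 ^ n"
proof -
  have "real (cells \<alpha> n) \<le> 2 powr (\<alpha> * real n)"
    by (rule cells_bounds[OF assms])
  also have "\<dots> \<le> 2 powr real n"
    using assms by (intro powr_mono) (auto simp: mult_left_le_one_le)
  finally show ?thesis
    by (simp add: powr_realpow of_nat_le_numeral_power_cancel_iff)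
qed

lemma cells_pos: "0 < cells \<alpha> n"
  by (induction n) auto

text \<open>The Fourier transform of the uniform distribution on the left endpoints \<open>a k / 2\<^sup>n\<close>, \<open>k < m\<close>.\<close>

definition expsum :: "(nat \<Rightarrow> nat) \<Rightarrow> nat \<Rightarrow> nat \<Rightarrow> real \<Rightarrow> complex" where
  "expsum a m n \<xi> = (\<Sum>k<m. fexp (\<xi> * real (a k) / 2 ^ n)) / of_nat m"

lemma sum_lessThan_double:
  fixes f :: "nat \<Rightarrow> 'a :: comm_monoid_add"
  shows "(\<Sum>k<2 * m. f k) = (\<Sum>k<m. f (2 * k) + f (Suc (2 * k)))"
  by (induction m) (simp_all add: add_ac)

text \<open>The children of cell \<open>k\<close> get the numbers \<open>2 * k\<close> and
  \<open>2 * k + 1\<close>; each pair contributes its parent's term times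
  \<open>1 + fexp (\<xi> / 2 ^ Suc n)\<close>, so keeping both halves causes no error.\<close>

lemma expsum_double:
  assumes "0 < m"
  shows "expsum (\<lambda>k. 2 * a (k div 2) + k mod 2) (2 * m) (Suc n) \<xi>
    = expsum a m n \<xi> * (1 + fexp (\<xi> / 2 ^ Suc n)) / 2"
proof -
  have "fexp (\<xi> * real (Suc (2 * j)) / 2 ^ Suc n) = fexp (\<xi> * real j / 2 ^ n) * fexp (\<xi> / 2 ^ Suc n)" for j
    unfolding fexp_add[symmetric] by (rule arg_cong[of _ _ fexp]) (simp add: field_simps)
  moreover have "\<xi> * real (2 * j) / 2 ^ Suc n = \<xi> * real j / 2 ^ n" for j
    by simp
  ultimately have "(\<Sum>k<2 * m. fexp (\<xi> * real (2 * a (k div 2) + k mod 2) / 2 ^ Suc n))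
     = (\<Sum>k<m. fexp (\<xi> * real (a k) / 2 ^ n) * (1 + fexp (\<xi> / 2 ^ Suc n)))"
    unfolding sum_lessThan_double by (simp add: distrib_left del: of_nat_Suc of_nat_mult power_Suc)
  then show ?thesis
    unfolding expsum_def sum_distrib_right[symmetric] by simp
qed

text \<open>Keeping one half equals the average over both halves plus or minus half their
  difference. The total deviation is therefore a signed exponential sum over the old cells times a
  factor of modulus at most 1.\<close>

lemma exists_halves_expsum_le:
  assumes a: "\<And>k. k < m \<Longrightarrow> a k < 2 ^ n" and m: "0 < m" "m \<le> 2 ^ n"
  shows "\<exists>b. (\<forall>k. b k < (2 :: nat)) \<and> (\<forall>\<xi>.
    cmod (expsum (\<lambda>k. 2 * a k + b k) m (Suc n) \<xi> - expsum a m n \<xi> * (1 + fexp (\<xi> / 2 ^ Suc n)) / 2)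
      \<le> 16 * sqrt (real (Suc n)) / sqrt (real m))"
proof -
  obtain \<epsilon> where \<epsilon>: "\<And>k. \<epsilon> k \<in> {1, -1 :: real}"
    and le: "\<And>\<xi>. cmod (\<Sum>k<m. of_real (\<epsilon> k) * fexp (\<xi> * real (a k) / 2 ^ n)) \<le> 16 * sqrt (real m * real (Suc n))"
    using exists_signs_exponential_sum_le[where a = a, OF assms] by blast
  \<comment> \<open>Sign 1 keeps the left half, sign -1 the right half.\<close>
  define b where "b k = (if \<epsilon> k = 1 then 0 else 1 :: nat)" for k
  have "cmod (expsum (\<lambda>k. 2 * a k + b k) m (Suc n) \<xi> - expsum a m n \<xi> * (1 + fexp (\<xi> / 2 ^ Suc n)) / 2)
      \<le> 16 * sqrt (real (Suc n)) / sqrt (real m)" for \<xi>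
  proof -
    define z where "z = fexp (\<xi> / 2 ^ Suc n)"
    have term_eq: "fexp (\<xi> * real (2 * a k + b k) / 2 ^ Suc n) - fexp (\<xi> * real (a k) / 2 ^ n) * (1 + z) / 2
        = (1 - z) / 2 * (of_real (\<epsilon> k) * fexp (\<xi> * real (a k) / 2 ^ n))" for k
    proof -
      have "\<xi> * real (2 * a k + b k) / 2 ^ Suc n = \<xi> * real (a k) / 2 ^ n + real (b k) * (\<xi> / 2 ^ Suc n)"
        by (simp add: field_simps)
      then have "fexp (\<xi> * real (2 * a k + b k) / 2 ^ Suc n)
          = fexp (\<xi> * real (a k) / 2 ^ n) * (if \<epsilon> k = 1 then 1 else z)"
        by (simp add: fexp_add b_def z_def)
      then show ?thesis
        using \<epsilon>[of k] by (auto simp: field_simps)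
    qed
    have sum_eq: "(\<Sum>k<m. fexp (\<xi> * real (2 * a k + b k) / 2 ^ Suc n))
          - (\<Sum>k<m. fexp (\<xi> * real (a k) / 2 ^ n)) * (1 + z) / 2
        = (1 - z) / 2 * (\<Sum>k<m. of_real (\<epsilon> k) * fexp (\<xi> * real (a k) / 2 ^ n))"
      by (simp only: sum_distrib_right sum_divide_distrib sum_distrib_left sum_subtractf[symmetric] term_eq)
    have "expsum (\<lambda>k. 2 * a k + b k) m (Suc n) \<xi> - expsum a m n \<xi> * (1 + z) / 2
        = ((\<Sum>k<m. fexp (\<xi> * real (2 * a k + b k) / 2 ^ Suc n))
          - (\<Sum>k<m. fexp (\<xi> * real (a k) / 2 ^ n)) * (1 + z) / 2) / of_nat m"
      unfolding expsum_def diff_divide_distrib by simp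
    also have "\<dots> = (1 - z) / 2 * (\<Sum>k<m. of_real (\<epsilon> k) * fexp (\<xi> * real (a k) / 2 ^ n)) / of_nat m"
      by (simp only: sum_eq)
    also have "cmod \<dots> = cmod (1 - z) / 2 * cmod (\<Sum>k<m. of_real (\<epsilon> k) * fexp (\<xi> * real (a k) / 2 ^ n)) / real m"
      by (simp add: norm_mult norm_divide)
    also have "\<dots> \<le> 1 * (16 * sqrt (real m * real (Suc n))) / real m"
    proof (intro divide_right_mono mult_mono le)
      show "cmod (1 - z) / 2 \<le> 1"
        using norm_triangle_ineq4[of 1 z] by (simp add: z_def)
    qed auto
    also have "\<dots> = 16 * sqrt (real (Suc n)) / sqrt (real m)"
    proof -
      have "sqrt (real m) / real m = 1 / sqrt (real m)"
        using m by (simp add: field_simps)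
      then have "16 * sqrt (real (Suc n)) * (sqrt (real m) / real m) = 16 * sqrt (real (Suc n)) / sqrt (real m)"
        by simp
      then show ?thesis
        by (simp only: real_sqrt_mult times_divide_eq_right mult_1 mult_ac)
    qed
    finally show ?thesis
      unfolding z_def .
  qed
  moreover have "b k < 2" for k
    by (simp add: b_def)
  ultimately show ?thesis
    by blast
qed

text \<open>\<open>M (Suc n) div M n\<close> is 1 or 2, so \<open>parent\<close> covers both kinds
  of step, as does \<open>expsum_step\<close>, where keeping both halves gives error 0.\<close>

locale dyadic_cantor =
  fixes \<alpha> :: real and M :: "nat \<Rightarrow> nat" and a :: "nat \<Rightarrow> nat \<Rightarrow> nat"
  assumes \<alpha>: "0 < \<alpha>" "\<alpha> < 1"
    and M_0: "M 0 = 1"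
    and M_Suc: "M (Suc n) = M n \<or> M (Suc n) = 2 * M n"
    and M_le: "real (M n) \<le> 2 powr (\<alpha> * real n)"
    and M_ge: "2 powr (\<alpha> * real n) \<le> 2 * real (M n)"
    and inj_a: "inj_on (a n) {..<M n}"
    and a_less: "k < M n \<Longrightarrow> a n k < 2 ^ n"
    and parent: "k < M (Suc n) \<Longrightarrow> a (Suc n) k div 2 = a n (k div (M (Suc n) div M n))"
    and expsum_step: "cmod (expsum (a (Suc n)) (M (Suc n)) (Suc n) \<xi>
        - expsum (a n) (M n) n \<xi> * (1 + fexp (\<xi> / 2 ^ Suc n)) / 2)
      \<le> 32 * (sqrt (real (Suc n)) * (2 powr (- \<alpha> / 2)) ^ n)"

lemma exists_dyadic_cantor:
  assumes \<alpha>: "0 < \<alpha>" "\<alpha> < 1"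
  shows "\<exists>M a. dyadic_cantor \<alpha> M a"
proof -
  define M where "M = cells \<alpha>"
  have M_pos: "0 < M n" for n
    by (simp add: M_def cells_pos)
  have M_Suc: "M (Suc n) = M n \<or> M (Suc n) = 2 * M n" for n
    by (simp add: M_def)
  \<comment> \<open>Dependent choice wants the conditions on one generation apart from those linking
    two consecutive ones; \<open>Q\<close> collects the latter.\<close>
  define Q where "Q n f f' \<longleftrightarrow> (\<forall>k<M (Suc n). f' k div 2 = f (k div (M (Suc n) div M n))) \<and>
    (\<forall>\<xi>. cmod (expsum f' (M (Suc n)) (Suc n) \<xi>
        - expsum f (M n) n \<xi> * (1 + fexp (\<xi> / 2 ^ Suc n)) / 2)
      \<le> 32 * (sqrt (real (Suc n)) * (2 powr (- \<alpha> / 2)) ^ n))" for n and f f' :: "nat \<Rightarrow> nat"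
  have "\<exists>a. \<forall>n. (inj_on (a n) {..<M n} \<and> (\<forall>k<M n. a n k < (2 :: nat) ^ n)) \<and> Q n (a n) (a (Suc n))"
  proof (rule dependent_nat_choice)
    show "\<exists>f :: nat \<Rightarrow> nat. inj_on f {..<M 0} \<and> (\<forall>k<M 0. f k < 2 ^ 0)"
      by (rule exI[of _ "\<lambda>_. 0"]) (auto simp: M_def inj_on_def)
  next
    fix f :: "nat \<Rightarrow> nat" and n assume f: "inj_on f {..<M n} \<and> (\<forall>k<M n. f k < 2 ^ n)"
    show "\<exists>f'. (inj_on f' {..<M (Suc n)} \<and> (\<forall>k<M (Suc n). f' k < 2 ^ Suc n)) \<and> Q n f f'"
      using M_Suc[of n]
    proof
      assume M2: "M (Suc n) = 2 * M n"
      let ?f' = "\<lambda>k. 2 * f (k div 2) + k mod 2"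
      have "inj_on ?f' {..<M (Suc n)}"
      proof (rule inj_onI)
        fix j k assume jk: "j \<in> {..<M (Suc n)}" "k \<in> {..<M (Suc n)}" "?f' j = ?f' k"
        have "?f' i div 2 = f (i div 2)" "?f' i mod 2 = i mod 2" for i
          by auto
        with jk(3) have "f (j div 2) = f (k div 2)" "j mod 2 = k mod 2"
          by metis+
        moreover have "j div 2 < M n" "k div 2 < M n"
          using jk M2 by auto
        ultimately have "j div 2 = k div 2"
          using f by (auto dest: inj_onD)
        then show "j = k"
          using \<open>j mod 2 = k mod 2\<close> by (metis mult_div_mod_eq)
      qed
      moreover have "?f' k < 2 ^ Suc n" if "k < M (Suc n)" for k
      proof -
        have "f (k div 2) < 2 ^ n"
          using f that M2 by auto
        then show ?thesis by simp
      qed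
      moreover have "Q n f ?f'"
        unfolding Q_def M2 expsum_double[OF M_pos] using M_pos[of n] by simp
      ultimately show ?thesis
        by blast
    next
      assume M1: "M (Suc n) = M n"
      obtain b where b: "\<And>k. b k < (2 :: nat)" and le: "\<And>\<xi>.
        cmod (expsum (\<lambda>k. 2 * f k + b k) (M n) (Suc n) \<xi> - expsum f (M n) n \<xi> * (1 + fexp (\<xi> / 2 ^ Suc n)) / 2)
          \<le> 16 * sqrt (real (Suc n)) / sqrt (real (M n))"
        using exists_halves_expsum_le[of "M n" f n] f M_pos[of n] cells_le_power[OF \<alpha>, of n]
        unfolding M_def by blast
      let ?f' = "\<lambda>k. 2 * f k + b k"
      have div: "?f' k div 2 = f k" for k
        using b[of k] by simp
      then have "inj_on ?f' {..<M (Suc n)}"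
        using f unfolding M1 inj_on_def by metis
      moreover have "?f' k < 2 ^ Suc n" if "k < M (Suc n)" for k
      proof -
        have "f k < 2 ^ n"
          using f that M1 by auto
        then show ?thesis
          using b[of k] by simp
      qed
      moreover have "Q n f ?f'"
      proof -
        \<comment> \<open>With \<open>r\<close> equal to \<open>2 powr (- \<alpha> * n / 2)\<close>,
          the lower bound on \<open>M n\<close> gives \<open>1 / sqrt (M n) \<le> 2 * r\<close>;
          this turns 16 into 32. The factor 2 is relaxed to 4 only to obtain a square.\<close>
        define r where "r = (2 powr (- \<alpha> / 2)) ^ n"
        have "r > 0" by (simp add: r_def)
        have "r\<^sup>2 = 2 powr (- (\<alpha> * real n))"
          by (simp add: r_def powr_powr mult_ac flip: powr_realpow power_mult)
        then have "1 = 2 powr (\<alpha> * real n) * r\<^sup>2"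
          by (simp add: powr_minus)
        also have "\<dots> \<le> 2 * real (M n) * r\<^sup>2"
          using cells_bounds(2)[OF \<alpha>, of n] by (intro mult_right_mono) (auto simp: M_def)
        also have "\<dots> \<le> 4 * real (M n) * r\<^sup>2"
          using \<open>r > 0\<close> by (intro mult_right_mono) auto
        also have "\<dots> = (2 * r * sqrt (real (M n)))\<^sup>2"
          by (simp add: power_mult_distrib)
        finally have "1 \<le> 2 * r * sqrt (real (M n))"
          using \<open>r > 0\<close> by (intro power2_le_imp_le[of 1]) auto
        then have "16 * sqrt (real (Suc n)) * 1 \<le> 16 * sqrt (real (Suc n)) * (2 * r * sqrt (real (M n)))"
          by (intro mult_left_mono) auto
        then have "16 * sqrt (real (Suc n)) / sqrt (real (M n)) \<le> 32 * (sqrt (real (Suc n)) * r)"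
          using M_pos[of n] by (simp add: field_simps)
        then show ?thesis
          using div M_pos[of n] order_trans[OF le] unfolding Q_def M1 r_def by simp
      qed
      ultimately show ?thesis
        by blast
    qed
  qed
  then obtain a where "\<And>n. inj_on (a n) {..<M n}" "\<And>n k. k < M n \<Longrightarrow> a n k < 2 ^ n"
    "\<And>n. Q n (a n) (a (Suc n))"
    by blast
  then have "dyadic_cantor \<alpha> M a"
    using M_Suc cells_bounds[OF \<alpha>] \<alpha> unfolding Q_def
    by unfold_locales (auto simp: M_def intro: less_imp_le)
  then show ?thesis by blast
qed

subsection \<open>Regularity of the limit measure\<close>

lemma exists_dyadic_scale:
  fixes y :: real
  assumes "1 \<le> y"
  shows "\<exists>n. 2 ^ n \<le> y \<and> y < 2 ^ Suc n"
proof -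
  obtain m where "y < 2 ^ m"
    using real_arch_pow[of 2 y] by auto
  define n where "n = (LEAST m. y < 2 ^ m)"
  have n: "y < 2 ^ n"
    unfolding n_def by (rule LeastI) fact
  then obtain j where j: "n = Suc j"
    using assms by (cases n) auto
  then have "\<not> y < 2 ^ j"
    using not_less_Least[of j "\<lambda>m. y < 2 ^ m"] by (simp add: n_def)
  with n j show ?thesis
    by (intro exI[of _ j]) auto
qed

lemma dyadic_powr: "(1 / 2 ^ n) powr \<alpha> = 2 powr (- (\<alpha> * real n))" for \<alpha> :: real
proof -
  have "1 / 2 ^ n = (2 :: real) powr (- real n)"
    by (simp add: powr_minus_divide powr_realpow)
  then show ?thesis
    by (simp only: powr_powr) (simp add: mult.commute)
qed

context dyadic_cantor
begin

lemma M_pos: "0 < M n"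
proof -
  have "0 < 2 powr (\<alpha> * real n)"
    by simp
  with M_ge[of n] have "0 < real (M n)"
    by linarith
  then show ?thesis
    by simp
qed

text \<open>A parameter in \<open>{0..<1}\<close> picks in each generation one of \<open>M n\<close>
  cells, numbered by equal subintervals. The measure is then the law of the limiting point under a
  uniform parameter, and all cells have equal mass by construction.\<close>

definition idx :: "nat \<Rightarrow> real \<Rightarrow> nat" where
  "idx n \<omega> = nat \<lfloor>real (M n) * \<omega>\<rfloor>"

definition pt :: "nat \<Rightarrow> real \<Rightarrow> real" where
  "pt n \<omega> = real (a n (idx n \<omega>)) / 2 ^ n"

definition lim_pt :: "real \<Rightarrow> real" where
  "lim_pt \<omega> = lim (\<lambda>n. pt n \<omega>)"

abbreviation U :: "real measure" where
  "U \<equiv> restrict_space lborel {0..<1}"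

definition cantor_measure :: "real measure" where
  "cantor_measure = distr U borel lim_pt"

text \<open>The closure makes compactness immediate; centres outside the image are reached by
  approximation.\<close>

definition cantor_set :: "real set" where
  "cantor_set = closure (lim_pt ` {0..<1})"

lemma idx_eq_iff:
  assumes "0 \<le> \<omega>"
  shows "idx n \<omega> = k \<longleftrightarrow> real k / real (M n) \<le> \<omega> \<and> \<omega> < (real k + 1) / real (M n)"
proof -
  have "0 \<le> real (M n) * \<omega>"
    using assms by simp
  then have "idx n \<omega> = k \<longleftrightarrow> real k \<le> real (M n) * \<omega> \<and> real (M n) * \<omega> < real k + 1"
    using nat_floor_bounds[of "real (M n) * \<omega>"] unfolding idx_def
    by (metis floor_unique nat_int of_int_of_nat_eq)
  then show ?thesis
    using M_pos[of n] by (simp add: field_simps)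
qed

lemma idx_bounds:
  assumes "0 \<le> \<omega>"
  shows "real (idx n \<omega>) \<le> real (M n) * \<omega>" and "real (M n) * \<omega> < real (idx n \<omega>) + 1"
proof -
  have "0 \<le> real (M n) * \<omega>"
    using assms by simp
  then show "real (idx n \<omega>) \<le> real (M n) * \<omega>" "real (M n) * \<omega> < real (idx n \<omega>) + 1"
    unfolding idx_def by (rule nat_floor_bounds)+
qed

lemma idx_less:
  assumes "0 \<le> \<omega>" "\<omega> < 1"
  shows "idx n \<omega> < M n"
proof -
  have "real (M n) * \<omega> < real (M n) * 1"
    using assms M_pos[of n] by (intro mult_strict_left_mono) auto
  then have "real (idx n \<omega>) < real (M n)"
    using idx_bounds(1)[OF assms(1), of n] by linarith
  then show ?thesis
    by simp
qed

text \<open>The parameter partitions are nested: halving and rounding down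
  \<open>\<lfloor>2 * y\<rfloor>\<close> gives \<open>\<lfloor>y\<rfloor>\<close>.\<close>

lemma idx_Suc_div:
  assumes "0 \<le> \<omega>"
  shows "idx (Suc n) \<omega> div (M (Suc n) div M n) = idx n \<omega>"
  using M_Suc[of n]
proof
  assume M2: "M (Suc n) = 2 * M n"
  define j where "j = idx (Suc n) \<omega>"
  have "real j \<le> 2 * (real (M n) * \<omega>)" "2 * (real (M n) * \<omega>) < real j + 1"
    using idx_bounds[OF assms, of "Suc n"] by (simp_all only: j_def M2 of_nat_mult of_nat_numeral mult.assoc)
  moreover have "real j = 2 * real (j div 2) + real (j mod 2)"
    by (metis mult_div_mod_eq of_nat_add of_nat_mult of_nat_numeral)
  moreover have "real (j mod 2) \<le> 1"
    by simp
  ultimately have "real (j div 2) \<le> real (M n) * \<omega>" "real (M n) * \<omega> < real (j div 2) + 1"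
    by linarith+
  then have "idx n \<omega> = j div 2"
    using idx_eq_iff[OF assms] M_pos[of n] by (simp add: field_simps)
  then show ?thesis
    using M_pos[of n] by (simp add: j_def M2)
qed (simp add: idx_def M_pos)

text \<open>The chosen child is the left or the right half of its parent, so the closed cells along
  one parameter are nested.\<close>

lemma pt_Suc:
  assumes "0 \<le> \<omega>" "\<omega> < 1"
  shows "pt n \<omega> \<le> pt (Suc n) \<omega>" and "pt (Suc n) \<omega> + 1 / 2 ^ Suc n \<le> pt n \<omega> + 1 / 2 ^ n"
proof -
  define j where "j = a (Suc n) (idx (Suc n) \<omega>)"
  have "j div 2 = a n (idx n \<omega>)"
    using parent[OF idx_less[OF assms, of "Suc n"]] idx_Suc_div[OF assms(1)] by (simp add: j_def)
  then have "j = 2 * a n (idx n \<omega>) \<or> j = 2 * a n (idx n \<omega>) + 1"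
    by presburger
  then have "real j = 2 * real (a n (idx n \<omega>)) \<or> real j = 2 * real (a n (idx n \<omega>)) + 1"
    by auto
  then show "pt n \<omega> \<le> pt (Suc n) \<omega>" "pt (Suc n) \<omega> + 1 / 2 ^ Suc n \<le> pt n \<omega> + 1 / 2 ^ n"
    by (auto simp: pt_def j_def[symmetric] field_simps)
qed

lemma pt_bounds:
  assumes "0 \<le> \<omega>" "\<omega> < 1"
  shows "0 \<le> pt n \<omega>" and "pt n \<omega> + 1 / 2 ^ n \<le> 1"
proof -
  have "Suc (a n (idx n \<omega>)) \<le> 2 ^ n"
    using a_less[OF idx_less[OF assms], of n] by simp
  then have "real (Suc (a n (idx n \<omega>))) \<le> 2 ^ n"
    by (metis of_nat_le_numeral_power_cancel_iff)
  then show "0 \<le> pt n \<omega>" "pt n \<omega> + 1 / 2 ^ n \<le> 1"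
    by (simp_all add: pt_def field_simps)
qed

lemma pt_tendsto:
  assumes "0 \<le> \<omega>" "\<omega> < 1"
  shows "(\<lambda>n. pt n \<omega>) \<longlonglongrightarrow> lim_pt \<omega>"
proof -
  have "incseq (\<lambda>n. pt n \<omega>)"
    using pt_Suc(1)[OF assms] by (rule incseq_SucI)
  moreover have "Bseq (\<lambda>n. pt n \<omega>)"
  proof (rule BseqI')
    fix n
    have "0 \<le> 1 / (2 :: real) ^ n" by simp
    then show "norm (pt n \<omega>) \<le> 1"
      using pt_bounds[OF assms, of n] by (simp only: real_norm_def abs_of_nonneg)
  qed
  ultimately show ?thesis
    unfolding lim_pt_def convergent_LIMSEQ_iff[symmetric]
    by (intro Bseq_monoseq_convergent incseq_imp_monoseq)
qed

lemma lim_pt_bounds: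
  assumes "0 \<le> \<omega>" "\<omega> < 1"
  shows "pt n \<omega> \<le> lim_pt \<omega>" and "lim_pt \<omega> \<le> pt n \<omega> + 1 / 2 ^ n"
proof -
  show "pt n \<omega> \<le> lim_pt \<omega>"
    by (intro incseq_le[OF _ pt_tendsto] incseq_SucI pt_Suc assms)
  have "(\<lambda>n. 1 / (2 :: real) ^ n) \<longlonglongrightarrow> 0"
    by real_asymp
  then have "(\<lambda>n. pt n \<omega> + 1 / 2 ^ n) \<longlonglongrightarrow> lim_pt \<omega> + 0"
    by (intro tendsto_add pt_tendsto assms)
  moreover have "decseq (\<lambda>n. pt n \<omega> + 1 / 2 ^ n)"
    by (intro decseq_SucI pt_Suc assms)
  ultimately show "lim_pt \<omega> \<le> pt n \<omega> + 1 / 2 ^ n"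
    using decseq_ge[of "\<lambda>n. pt n \<omega> + 1 / 2 ^ n" "lim_pt \<omega> + 0" n] by simp
qed

lemma lim_pt_range:
  assumes "0 \<le> \<omega>" "\<omega> < 1"
  shows "lim_pt \<omega> \<in> {0..1}"
  using lim_pt_bounds[OF assms, of 0] pt_bounds[OF assms, of 0] by simp

lemma space_U [simp]: "space U = {0..<1}"
  by (simp add: space_restrict_space)

lemma prob_space_U: "prob_space U"
  by (rule prob_space_restrict_space) auto

lemma idx_measurable: "idx n \<in> measurable U (count_space UNIV)"
  unfolding idx_def by (intro measurable_restrict_space1) measurable

lemma pt_measurable: "pt n \<in> borel_measurable U"
proof -
  have "(\<lambda>j. real (a n j) / 2 ^ n) \<in> measurable (count_space UNIV) borel"
    by simp
  from measurable_compose[OF idx_measurable this] show ?thesis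
    by (simp add: pt_def[abs_def])
qed

lemma lim_pt_measurable: "lim_pt \<in> borel_measurable U"
  by (rule borel_measurable_LIMSEQ_real[OF _ pt_measurable]) (auto intro: pt_tendsto)

lemma measure_idx_eq:
  assumes "k < M n"
  shows "measure U (idx n -` {k} \<inter> {0..<1}) = 1 / real (M n)"
proof -
  define l u where "l = real k / real (M n)" and "u = (real k + 1) / real (M n)"
  have lu: "0 \<le> l" "u \<le> 1" "u - l = 1 / real (M n)"
    using assms M_pos[of n] by (simp_all add: l_def u_def field_simps flip: of_nat_Suc)
  have "idx n \<omega> = k \<longleftrightarrow> l \<le> \<omega> \<and> \<omega> < u" if "0 \<le> \<omega>" for \<omega>
    unfolding l_def u_def using that by (rule idx_eq_iff)
  with lu have "idx n -` {k} \<inter> {0..<1} = {l..<u}"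
    by fastforce
  moreover have "measure U (idx n -` {k} \<inter> {0..<1}) = measure lborel (idx n -` {k} \<inter> {0..<1})"
    by (rule measure_restrict_space) auto
  moreover have "0 \<le> u - l"
    unfolding lu by simp
  ultimately show ?thesis
    using lu by simp
qed

lemma idx_sets: "idx n -` K \<inter> {0..<1} \<in> sets U"
  using measurable_sets[OF idx_measurable, of K n] by simp

lemma measure_idx_in:
  assumes "K \<subseteq> {..<M n}"
  shows "measure U (idx n -` K \<inter> {0..<1}) = real (card K) / real (M n)"
proof -
  interpret U: prob_space U
    by (rule prob_space_U)
  have fin: "finite K"
    using assms finite_subset by blast
  have "idx n -` K \<inter> {0..<1} = (\<Union>k\<in>K. idx n -` {k} \<inter> {0..<1})"
    by auto
  also have "measure U \<dots> = (\<Sum>k\<in>K. measure U (idx n -` {k} \<inter> {0..<1}))"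
    using fin idx_sets by (intro U.finite_measure_finite_Union) (auto simp: disjoint_family_on_def)
  also have "\<dots> = (\<Sum>k\<in>K. 1 / real (M n))"
    using assms by (intro sum.cong measure_idx_eq) auto
  finally show ?thesis
    by simp
qed

lemma integral_idx:
  fixes g :: "nat \<Rightarrow> complex"
  shows "(\<integral>\<omega>. g (idx n \<omega>) \<partial>U) = (\<Sum>k<M n. g k) / of_nat (M n)"
proof -
  interpret U: prob_space U
    by (rule prob_space_U)
  have "(\<integral>\<omega>. g (idx n \<omega>) \<partial>U) = (\<integral>\<omega>. (\<Sum>k<M n. indicator (idx n -` {k} \<inter> {0..<1}) \<omega> *\<^sub>R g k) \<partial>U)"
  proof (rule Bochner_Integration.integral_cong)
    fix \<omega> assume \<omega>: "\<omega> \<in> space U"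
    have "(\<Sum>k<M n. indicator (idx n -` {k} \<inter> {0..<1}) \<omega> *\<^sub>R g k)
        = (\<Sum>k<M n. if k = idx n \<omega> then g k else 0)"
      using \<omega> by (intro sum.cong) (auto simp: indicator_def)
    then show "g (idx n \<omega>) = (\<Sum>k<M n. indicator (idx n -` {k} \<inter> {0..<1}) \<omega> *\<^sub>R g k)"
      using \<omega> idx_less[of \<omega> n] by simp
  qed simp
  also have "\<dots> = (\<Sum>k<M n. (\<integral>\<omega>. indicator (idx n -` {k} \<inter> {0..<1}) \<omega> *\<^sub>R g k \<partial>U))"
    using idx_sets by (intro Bochner_Integration.integral_sum)
      (auto intro!: integrable_scaleR_left simp: U.emeasure_eq_measure)
  also have "\<dots> = (\<Sum>k<M n. (1 / real (M n)) *\<^sub>R g k)"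
  proof (intro sum.cong refl)
    fix k assume "k \<in> {..<M n}"
    then show "(\<integral>\<omega>. indicator (idx n -` {k} \<inter> {0..<1}) \<omega> *\<^sub>R g k \<partial>U) = (1 / real (M n)) *\<^sub>R g k"
      using idx_sets[of n "{k}"] measure_idx_eq[of k n] 
      by (subst integral_scaleR_left) (auto simp: U.emeasure_eq_measure Int_absorb2)
  qed
  also have "\<dots> = (\<Sum>k<M n. g k) / of_nat (M n)"
    by (simp add: scaleR_conv_of_real sum_divide_distrib)
  finally show ?thesis .
qed

lemma real_distribution_cantor_measure: "real_distribution cantor_measure"
  unfolding cantor_measure_def
  by (intro prob_space.real_distribution_distr prob_space_U lim_pt_measurable)

lemma measure_cantor:
  assumes "B \<in> sets borel"
  shows "measure cantor_measure B = measure U (lim_pt -` B \<inter> {0..<1})"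
  unfolding cantor_measure_def using measure_distr[OF lim_pt_measurable assms] by simp

lemma compact_cantor_set: "compact cantor_set"
proof -
  have "lim_pt ` {0..<1} \<subseteq> {0..1}"
    using lim_pt_range by (simp add: image_subset_iff)
  then have "bounded (lim_pt ` {0..<1})"
    by (rule bounded_subset[OF bounded_closed_interval])
  then show ?thesis
    by (simp add: cantor_set_def compact_closure)
qed

lemma measure_cantor_set: "measure cantor_measure cantor_set = 1"
proof -
  have "cantor_set \<in> sets borel"
    by (simp add: cantor_set_def)
  moreover have "lim_pt -` cantor_set \<inter> {0..<1} = space U"
    using closure_subset[of "lim_pt ` {0..<1}"] by (auto simp: cantor_set_def)
  ultimately show ?thesis
    using prob_space.prob_space[OF prob_space_U] by (simp add: measure_cantor)
qed

text \<open>\<open>expsum\<close> is the transform of the law of \<open>pt n\<close>; dominated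
  convergence with the constant bound 1 passes to the limit.\<close>

lemma expsum_tendsto_fourier:
  "(\<lambda>n. expsum (a n) (M n) n \<xi>) \<longlonglongrightarrow> fourier_measure cantor_measure \<xi>"
proof -
  interpret U: prob_space U
    by (rule prob_space_U)
  have fexp_meas: "(\<lambda>x. fexp (\<xi> * x)) \<in> borel_measurable borel"
    unfolding fexp_def by (intro borel_measurable_continuous_onI continuous_intros)
  have "fourier_measure cantor_measure \<xi> = (\<integral>x. fexp (\<xi> * x) \<partial>cantor_measure)"
    unfolding fourier_measure_def fexp_def cis_conv_exp
    by (intro Bochner_Integration.integral_cong refl arg_cong[of _ _ exp]) (simp add: mult_ac)
  also have "\<dots> = (\<integral>\<omega>. fexp (\<xi> * lim_pt \<omega>) \<partial>U)"
    unfolding cantor_measure_def by (rule integral_distr[OF lim_pt_measurable fexp_meas])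
  finally have F: "fourier_measure cantor_measure \<xi> = (\<integral>\<omega>. fexp (\<xi> * lim_pt \<omega>) \<partial>U)" .
  have "(\<integral>\<omega>. fexp (\<xi> * pt n \<omega>) \<partial>U) = expsum (a n) (M n) n \<xi>" for n
    using integral_idx[of "\<lambda>k. fexp (\<xi> * (real (a n k) / 2 ^ n))" n]
    by (simp add: pt_def expsum_def)
  moreover have "(\<lambda>n. \<integral>\<omega>. fexp (\<xi> * pt n \<omega>) \<partial>U) \<longlonglongrightarrow> (\<integral>\<omega>. fexp (\<xi> * lim_pt \<omega>) \<partial>U)"
  proof (rule integral_dominated_convergence[where w = "\<lambda>_. 1"])
    show "AE \<omega> in U. (\<lambda>n. fexp (\<xi> * pt n \<omega>)) \<longlonglongrightarrow> fexp (\<xi> * lim_pt \<omega>)"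
      unfolding fexp_def by (intro AE_I2) (auto intro!: tendsto_intros pt_tendsto)
  qed (auto intro: measurable_compose[OF lim_pt_measurable fexp_meas] measurable_compose[OF pt_measurable fexp_meas])
  ultimately show ?thesis
    by (simp add: F)
qed

text \<open>At the scale with \<open>\<epsilon> \<le> 1 / 2 ^ n < 2 * \<epsilon>\<close> the
  interval meets at most 3 cells, each of mass at most
  \<open>2 * 2 powr (- (\<alpha> * real n))\<close>. Replacing the scale by
  \<open>2 * \<epsilon>\<close> costs another factor 2, hence 12.\<close>

lemma measure_Icc_le:
  assumes "0 < \<epsilon>" "\<epsilon> \<le> 1"
  shows "measure cantor_measure {x..x + \<epsilon>} \<le> 12 * \<epsilon> powr \<alpha>"
proof -
  interpret U: prob_space U
    by (rule prob_space_U)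
  obtain n where n: "2 ^ n \<le> 1 / \<epsilon>" "1 / \<epsilon> < 2 ^ Suc n"
    using exists_dyadic_scale[of "1 / \<epsilon>"] assms by auto
  then have n\<epsilon>: "2 ^ n * \<epsilon> \<le> 1" "1 < 2 ^ Suc n * \<epsilon>"
    using assms by (simp_all add: field_simps)
  define K where "K = {k. k < M n \<and> x \<le> real (a n k) / 2 ^ n + 1 / 2 ^ n \<and> real (a n k) / 2 ^ n \<le> x + \<epsilon>}"
  \<comment> \<open>The cell indices in question lie in a closed interval of length 2 starting at
    \<open>2 ^ n * x - 1\<close>, which holds at most three integers.\<close>
  define z where "z = \<lceil>2 ^ n * x - 1\<rceil>"
  have "(\<lambda>k. int (a n k)) ` K \<subseteq> {z..z + 2}"
  proof safe
    fix k assume "k \<in> K"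
    then have "x * 2 ^ n \<le> real (a n k) + 1" "real (a n k) \<le> (x + \<epsilon>) * 2 ^ n"
      unfolding K_def by (simp_all add: field_simps)
    then have "2 ^ n * x - 1 \<le> real (a n k)" "real (a n k) \<le> (2 ^ n * x - 1) + 2"
      using n\<epsilon> by (simp_all add: algebra_simps)
    then show "int (a n k) \<in> {z..z + 2}"
      unfolding z_def atLeastAtMost_iff by linarith
  qed
  then have "card ((\<lambda>k. int (a n k)) ` K) \<le> card {z..z + 2}"
    by (intro card_mono) auto
  moreover have "inj_on (\<lambda>k. int (a n k)) K"
    using inj_a[of n] unfolding K_def inj_on_def by auto
  ultimately have card: "card K \<le> 3"
    by (simp add: card_image)
  have "lim_pt -` {x..x + \<epsilon>} \<inter> {0..<1} \<subseteq> idx n -` K \<inter> {0..<1}"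
  proof
    fix \<omega> assume \<omega>: "\<omega> \<in> lim_pt -` {x..x + \<epsilon>} \<inter> {0..<1}"
    then show "\<omega> \<in> idx n -` K \<inter> {0..<1}"
      using lim_pt_bounds[of \<omega> n] idx_less[of \<omega> n] by (auto simp: K_def pt_def)
  qed
  then have "measure cantor_measure {x..x + \<epsilon>} \<le> measure U (idx n -` K \<inter> {0..<1})"
    using measure_cantor[of "{x..x + \<epsilon>}"] by (simp add: U.finite_measure_mono idx_sets)
  also have "\<dots> = real (card K) / real (M n)"
    by (rule measure_idx_in) (auto simp: K_def)
  also have "\<dots> \<le> 3 / real (M n)"
    using card by (intro divide_right_mono) auto
  also have "\<dots> \<le> 3 * (2 * 2 powr (- (\<alpha> * real n)))"
    using M_ge[of n] M_pos[of n] by (simp add: powr_minus field_simps)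
  also have "2 powr (- (\<alpha> * real n)) = (1 / 2 ^ n) powr \<alpha>"
    by (rule dyadic_powr[symmetric])
  also have "\<dots> \<le> (2 * \<epsilon>) powr \<alpha>"
    using n\<epsilon> \<alpha> by (intro powr_mono2) (auto simp: field_simps)
  also have "\<dots> \<le> 2 * \<epsilon> powr \<alpha>"
  proof -
    have "(2 :: real) powr \<alpha> \<le> 2 powr 1"
      using \<alpha> by (intro powr_mono) auto
    then show ?thesis
      using assms by (simp add: powr_mult mult_right_mono)
  qed
  finally show ?thesis
    by simp
qed

text \<open>Needed for intervals of length 0, where \<open>0 powr \<alpha> = 0\<close> makes the
  upper bound assert the absence of atoms.\<close>

lemma measure_singleton: "measure cantor_measure {x} = 0"
proof (rule ccontr)
  interpret \<mu>: real_distribution cantor_measure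
    by (rule real_distribution_cantor_measure)
  define m where "m = measure cantor_measure {x}"
  assume "measure cantor_measure {x} \<noteq> 0"
  then have m: "0 < m" "m \<le> 1"
    using measure_nonneg[of cantor_measure "{x}"] by (auto simp: m_def order_less_le)
  \<comment> \<open>Chosen so that \<open>12 * \<epsilon> powr \<alpha>\<close> is
    \<open>m / 2\<close>.\<close>
  define \<epsilon> where "\<epsilon> = (m / 24) powr (1 / \<alpha>)"
  have \<epsilon>: "0 < \<epsilon>" "\<epsilon> \<le> 1"
    using m \<alpha> by (auto simp: \<epsilon>_def intro: powr_le1)
  have "m \<le> measure cantor_measure {x..x + \<epsilon>}"
    unfolding m_def using \<epsilon> by (intro \<mu>.finite_measure_mono) auto
  also have "\<dots> \<le> 12 * \<epsilon> powr \<alpha>"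
    using \<epsilon> by (rule measure_Icc_le)
  also have "\<dots> = m / 2"
    using m \<alpha> by (simp add: \<epsilon>_def powr_powr)
  finally show False
    using m by simp
qed

lemma measure_interval_le:
  assumes "bounded I" "I \<noteq> {}" "interval_length I < 1"
  shows "measure cantor_measure I \<le> 12 * interval_length I powr \<alpha>"
proof -
  interpret \<mu>: real_distribution cantor_measure
    by (rule real_distribution_cantor_measure)
  have bdd: "bdd_below I" "bdd_above I"
    using assms by (auto intro: bounded_imp_bdd_below bounded_imp_bdd_above)
  define L where "L = interval_length I"
  have "I \<subseteq> {Inf I..Sup I}"
    using bdd by (auto intro: cInf_lower cSup_upper)
  then have sub: "I \<subseteq> {Inf I..Inf I + L}"
    by (simp add: L_def interval_length_def)
  then have le: "measure cantor_measure I \<le> measure cantor_measure {Inf I..Inf I + L}"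
    by (intro \<mu>.finite_measure_mono) auto
  have "0 \<le> L"
    using sub assms(2) by fastforce
  show ?thesis
  proof (cases "L = 0")
    case True
    with le show ?thesis
      by (simp add: measure_singleton L_def)
  next
    case False
    with le measure_Icc_le[of L "Inf I"] \<open>0 \<le> L\<close> assms(3) show ?thesis
      by (simp add: L_def)
  qed
qed

text \<open>A cell shorter than a quarter of the interval and close to its centre lies inside it,
  and its mass \<open>1 / M n\<close> is at least \<open>2 powr (- (\<alpha> * real n))\<close>. For
  length 0 the left side is 0.\<close>

lemma measure_interval_ge:
  assumes I: "is_interval I" "bounded I" "I \<noteq> {}" "interval_length I < 1"
    and "centered_in I cantor_set"
  shows "1 / 8 * interval_length I powr \<alpha> \<le> measure cantor_measure I"
proof (cases "interval_length I = 0")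
  case False
  interpret U: prob_space U
    by (rule prob_space_U)
  interpret \<mu>: real_distribution cantor_measure
    by (rule real_distribution_cantor_measure)
  have bdd: "bdd_below I" "bdd_above I"
    using I by (auto intro: bounded_imp_bdd_below bounded_imp_bdd_above)
  have "Inf I \<le> Sup I"
    using bdd I(3) by (intro cInf_le_cSup)
  define r where "r = interval_length I / 2"
  have r: "0 < r" "r < 1/2"
    using False \<open>Inf I \<le> Sup I\<close> I(4) by (auto simp: r_def interval_length_def)
  define x where "x = (Inf I + Sup I) / 2"
  have x: "x \<in> cantor_set"
    using assms(5) by (simp add: centered_in_def x_def)
  have sub: "{x - r<..<x + r} \<subseteq> I"
  proof
    fix y assume "y \<in> {x - r<..<x + r}"
    then have "Inf I < y" "y < Sup I"
      by (auto simp: x_def r_def interval_length_def field_simps)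
    then obtain u v where "u \<in> I" "u < y" "v \<in> I" "y < v"
      using cInf_lessD[OF I(3)] less_cSupD[OF I(3)] by blast
    then show "y \<in> I"
      using I(1) unfolding is_interval_1 by (meson less_imp_le)
  qed
  \<comment> \<open>The centre lies only in the closure: half the radius is spent on reaching a
    limit point, the other half on its cell.\<close>
  obtain \<omega> where \<omega>: "0 \<le> \<omega>" "\<omega> < 1" and x\<omega>: "\<bar>lim_pt \<omega> - x\<bar> < r / 2"
    using x r unfolding cantor_set_def closure_approachable dist_real_def
    by (metis (no_types, lifting) atLeastLessThan_iff half_gt_zero imageE)
  obtain m where m: "2 ^ m \<le> 2 / r" "2 / r < 2 ^ Suc m"
    using exists_dyadic_scale[of "2 / r"] r by auto
  define n where "n = Suc m"
  have n: "1 / 2 ^ n < r / 2" "r / 4 \<le> 1 / 2 ^ n"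
    using m r by (simp_all add: n_def field_simps)
  have "idx n -` {idx n \<omega>} \<inter> {0..<1} \<subseteq> lim_pt -` {x - r<..<x + r} \<inter> {0..<1}"
  proof
    fix \<omega>' assume \<omega>': "\<omega>' \<in> idx n -` {idx n \<omega>} \<inter> {0..<1}"
    then have "pt n \<omega>' = pt n \<omega>"
      by (simp add: pt_def)
    with \<omega>' have "\<bar>lim_pt \<omega>' - lim_pt \<omega>\<bar> \<le> 1 / 2 ^ n"
      using lim_pt_bounds[OF \<omega>, of n] lim_pt_bounds[of \<omega>' n] by (simp add: abs_le_iff)
    with n(1) x\<omega> have "\<bar>lim_pt \<omega>' - x\<bar> < r"
      by linarith
    with \<omega>' show "\<omega>' \<in> lim_pt -` {x - r<..<x + r} \<inter> {0..<1}"
      by (auto simp: abs_less_iff)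
  qed
  then have "measure U (idx n -` {idx n \<omega>} \<inter> {0..<1}) \<le> measure U (lim_pt -` {x - r<..<x + r} \<inter> {0..<1})"
    using measurable_sets[OF lim_pt_measurable, of "{x - r<..<x + r}"]
    by (intro U.finite_measure_mono) auto
  also have "\<dots> = measure cantor_measure {x - r<..<x + r}"
    by (simp add: measure_cantor)
  also have "\<dots> \<le> measure cantor_measure I"
  \<comment> \<open>Monotonicity needs \<open>I\<close> measurable: it is an open interval with at
    most two endpoints added.\<close>
  proof (rule \<mu>.finite_measure_mono[OF sub])
    have "I \<subseteq> {x - r..x + r}"
      using cInf_lower[OF _ bdd(1)] cSup_upper[OF _ bdd(2)]
      by (auto simp: x_def r_def interval_length_def field_simps)
    then have "I = {x - r<..<x + r} \<union> I \<inter> {x - r, x + r}"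
      using sub by fastforce
    moreover have "I \<inter> {x - r, x + r} \<in> sets borel"
      by (intro borel_closed finite_imp_closed) auto
    ultimately show "I \<in> sets cantor_measure"
      by (metis \<mu>.events_eq_borel borel_open open_greaterThanLessThan sets.Un)
  qed
  finally have le: "1 / real (M n) \<le> measure cantor_measure I"
    using measure_idx_eq[OF idx_less[OF \<omega>]] by simp
  define L where "L = interval_length I"
  have "0 < L" "L / 8 \<le> 1 / 2 ^ n"
    using r n by (auto simp: r_def L_def)
  \<comment> \<open>The cell length is at least \<open>L / 8\<close>, and
    \<open>(1/8) powr \<alpha>\<close> is at least \<open>1/8\<close> because
    \<open>\<alpha> < 1\<close>.\<close>
  have "1 / 8 * L powr \<alpha> \<le> (1 / 8) powr \<alpha> * L powr \<alpha>"
  proof (intro mult_right_mono)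
    have "(1 / 8 :: real) powr 1 \<le> (1 / 8) powr \<alpha>"
      using \<alpha> by (intro powr_mono') auto
    then show "1 / 8 \<le> (1 / 8 :: real) powr \<alpha>"
      by simp
  qed simp
  also have "\<dots> = (L / 8) powr \<alpha>"
    using \<open>0 < L\<close> by (simp flip: powr_mult)
  also have "\<dots> \<le> (1 / 2 ^ n) powr \<alpha>"
    using \<open>0 < L\<close> \<open>L / 8 \<le> 1 / 2 ^ n\<close> \<alpha> by (intro powr_mono2) auto
  also have "\<dots> = 1 / 2 powr (\<alpha> * real n)"
    by (simp add: dyadic_powr powr_minus_divide)
  also have "\<dots> \<le> 1 / real (M n)"
    using M_le[of n] M_pos[of n] by (intro divide_left_mono) auto
  also note le
  finally show ?thesis
    by (simp add: L_def)
qed simp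

subsection \<open>Fourier decay\<close>

text \<open>For nonzero \<open>\<xi>\<close> the product is the transform of the measure spread
  uniformly over generation \<open>n\<close>. By \<open>unif_ft_half\<close> it changes from one
  generation to the next only by the selection error times the kernel, and generation 0 contributes
  \<open>1 / \<bar>\<xi>\<bar>\<close>.\<close>

lemma norm_expsum_unif_ft_le:
  fixes \<xi> :: real and n :: nat
  defines "q \<equiv> 2 powr (- \<alpha> / 2)"
  shows "cmod (expsum (a n) (M n) n \<xi> * unif_ft (\<xi> / 2 ^ n))
    \<le> 1 / \<bar>\<xi>\<bar> + 32 * (\<Sum>j<n. sqrt (real (Suc j)) * q ^ j * min 1 (2 ^ Suc j / \<bar>\<xi>\<bar>))"
proof (induction n)
  case 0
  have "cmod (expsum (a 0) (M 0) 0 \<xi>) = 1"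
    by (simp add: expsum_def M_0)
  then show ?case
    using norm_unif_ft_le_inverse[of \<xi>] by (simp add: norm_mult)
next
  case (Suc n)
  define u where "u = \<xi> / 2 ^ Suc n"
  define d where "d = expsum (a (Suc n)) (M (Suc n)) (Suc n) \<xi> - expsum (a n) (M n) n \<xi> * (1 + fexp u) / 2"
  have "\<xi> / 2 ^ n / 2 = u"
    by (simp add: u_def)
  with unif_ft_half[of "\<xi> / 2 ^ n"] have "unif_ft (\<xi> / 2 ^ n) = unif_ft u * (1 + fexp u) / 2"
    by simp
  then have "expsum (a (Suc n)) (M (Suc n)) (Suc n) \<xi> * unif_ft u
      = expsum (a n) (M n) n \<xi> * unif_ft (\<xi> / 2 ^ n) + d * unif_ft u"
    by (simp add: d_def ring_distribs diff_divide_distrib add_divide_distrib mult_ac)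
  then have "cmod (expsum (a (Suc n)) (M (Suc n)) (Suc n) \<xi> * unif_ft u)
      \<le> cmod (expsum (a n) (M n) n \<xi> * unif_ft (\<xi> / 2 ^ n)) + cmod d * cmod (unif_ft u)"
    by (metis norm_mult norm_triangle_ineq)
  also have "cmod d * cmod (unif_ft u) \<le> 32 * (sqrt (real (Suc n)) * q ^ n) * min 1 (2 ^ Suc n / \<bar>\<xi>\<bar>)"
  proof (rule mult_mono)
    show "cmod d \<le> 32 * (sqrt (real (Suc n)) * q ^ n)"
      using expsum_step[of n \<xi>] by (simp only: d_def u_def q_def)
    have "1 / \<bar>u\<bar> = 2 ^ Suc n / \<bar>\<xi>\<bar>"
      by (simp add: u_def)
    then show "cmod (unif_ft u) \<le> min 1 (2 ^ Suc n / \<bar>\<xi>\<bar>)"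
      using norm_unif_ft_le_one[of u] norm_unif_ft_le_inverse[of u] by simp
  qed (auto simp: q_def)
  finally show ?case
    using Suc.IH by (simp add: u_def distrib_left)
qed

text \<open>As \<open>n\<close> grows the kernel at \<open>\<xi> / 2 ^ n\<close> tends to 1, so the
  uniform bound passes to the limit. Nonzero \<open>\<xi>\<close> keeps the arguments away from the
  junk value.\<close>

lemma norm_fourier_le:
  fixes \<xi> B :: real
  defines "q \<equiv> 2 powr (- \<alpha> / 2)"
  assumes "\<xi> \<noteq> 0"
    and "\<And>n. (\<Sum>j<n. sqrt (real (Suc j)) * q ^ j * min 1 (2 ^ Suc j / \<bar>\<xi>\<bar>)) \<le> B"
  shows "cmod (fourier_measure cantor_measure \<xi>) \<le> 1 / \<bar>\<xi>\<bar> + 32 * B"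
proof -
  have "(\<lambda>n. \<xi> / 2 ^ n) \<longlonglongrightarrow> 0"
    by real_asymp
  then have "filterlim (\<lambda>n. \<xi> / 2 ^ n) (at 0) sequentially"
    using assms(2) by (simp add: filterlim_at)
  then have "(\<lambda>n. unif_ft (\<xi> / 2 ^ n)) \<longlonglongrightarrow> 1"
    by (rule filterlim_compose[OF unif_ft_tendsto_one])
  from tendsto_norm[OF tendsto_mult[OF expsum_tendsto_fourier this]]
  have "(\<lambda>n. cmod (expsum (a n) (M n) n \<xi> * unif_ft (\<xi> / 2 ^ n))) \<longlonglongrightarrow> cmod (fourier_measure cantor_measure \<xi>)"
    by simp
  then show ?thesis
  proof (rule LIMSEQ_le_const2)
    show "\<exists>N. \<forall>n\<ge>N. cmod (expsum (a n) (M n) n \<xi> * unif_ft (\<xi> / 2 ^ n)) \<le> 1 / \<bar>\<xi>\<bar> + 32 * B"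
    proof (intro exI allI impI)
      fix n
      show "cmod (expsum (a n) (M n) n \<xi> * unif_ft (\<xi> / 2 ^ n)) \<le> 1 / \<bar>\<xi>\<bar> + 32 * B"
        using norm_expsum_unif_ft_le[of n \<xi>] assms(3)[of n] unfolding q_def by linarith
    qed
  qed
qed

text \<open>With \<open>2 ^ k \<le> \<bar>\<xi>\<bar> < 2 ^ Suc k\<close>, replacing
  \<open>sqrt (Suc k)\<close> by the logarithm and \<open>q ^ k\<close> by the power of
  \<open>\<bar>\<xi>\<bar>\<close> costs a factor 2 each, hence the 4.\<close>

lemma exists_fourier_decay_constant:
  "\<exists>C. \<forall>\<xi>. 2 \<le> \<bar>\<xi>\<bar> \<longrightarrow>
    cmod (fourier_measure cantor_measure \<xi>) \<le> C * \<bar>\<xi>\<bar> powr (- \<alpha> / 2) * (ln \<bar>\<xi>\<bar>) powr (1 / 2)"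
proof -
  define q where "q = (2 :: real) powr (- \<alpha> / 2)"
  have q: "1/2 < q" "q < 1"
  proof -
    have "(2::real) powr (-1) < q" "q < 2 powr 0"
      unfolding q_def using \<alpha> by (intro powr_less_mono; simp)+
    then show "1/2 < q" "q < 1"
      by (simp_all add: powr_minus)
  qed
  obtain D where D: "\<And>n k x. 2 ^ k \<le> x \<Longrightarrow>
    (\<Sum>j<n. sqrt (real (Suc j)) * q ^ j * min 1 (2 ^ Suc j / x)) \<le> D * sqrt (real (Suc k)) * q ^ k"
    using sum_sqrt_geometric_min_le[OF q] by blast
  \<comment> \<open>The empty sum, at \<open>k = 0\<close> and \<open>x = 1\<close>.\<close>
  have "0 \<le> D"
    using D[of 0 1 0] by simp
  have "cmod (fourier_measure cantor_measure \<xi>)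
      \<le> ((1 + 32 * D) * 4) * \<bar>\<xi>\<bar> powr (- \<alpha> / 2) * (ln \<bar>\<xi>\<bar>) powr (1 / 2)" if \<xi>: "2 \<le> \<bar>\<xi>\<bar>" for \<xi>
  proof -
    obtain k where k: "2 ^ k \<le> \<bar>\<xi>\<bar>" "\<bar>\<xi>\<bar> < 2 ^ Suc k"
      using exists_dyadic_scale[of "\<bar>\<xi>\<bar>"] \<xi> by auto
    have "1 / \<bar>\<xi>\<bar> \<le> (1/2) ^ k"
      using k \<xi> by (simp add: field_simps)
    also have "\<dots> \<le> q ^ k"
      using q by (intro power_mono) auto
    also have "\<dots> \<le> sqrt (real (Suc k)) * q ^ k"
      using q by simp
    finally have "1 / \<bar>\<xi>\<bar> \<le> sqrt (real (Suc k)) * q ^ k" .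
    moreover have "cmod (fourier_measure cantor_measure \<xi>) \<le> 1 / \<bar>\<xi>\<bar> + 32 * (D * sqrt (real (Suc k)) * q ^ k)"
      using \<xi> D[OF k(1)] unfolding q_def by (intro norm_fourier_le) auto
    ultimately have "cmod (fourier_measure cantor_measure \<xi>) \<le> (1 + 32 * D) * (sqrt (real (Suc k)) * q ^ k)"
      by (simp add: algebra_simps)
    also have "\<dots> \<le> (1 + 32 * D) * ((2 * sqrt (ln \<bar>\<xi>\<bar>)) * (2 * \<bar>\<xi>\<bar> powr (- \<alpha> / 2)))"
    proof (intro mult_left_mono mult_mono)
      \<comment> \<open>From \<open>\<bar>\<xi>\<bar> \<ge> 2\<close> follows
        \<open>k \<ge> 1\<close>, so \<open>Suc k \<le> 2 * k\<close>, while
        \<open>ln \<bar>\<xi>\<bar> \<ge> k / 2\<close>.\<close>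
      have "1 \<le> real k"
        using k \<xi> by (cases k) auto
      have "ln (2 ^ k) \<le> ln \<bar>\<xi>\<bar>"
        using k \<xi> by (subst ln_le_cancel_iff) auto
      moreover have "1 / 2 \<le> ln (2 :: real)"
        using ln_diff_le[of 1 "2 :: real"] by simp
      then have "real k * (1 / 2) \<le> real k * ln 2"
        by (intro mult_left_mono) auto
      ultimately have "real (Suc k) \<le> 4 * ln \<bar>\<xi>\<bar>"
        using \<open>1 \<le> real k\<close> unfolding of_nat_Suc ln_realpow by linarith
      then have "sqrt (real (Suc k)) \<le> sqrt (4 * ln \<bar>\<xi>\<bar>)"
        by (rule real_sqrt_le_mono)
      then show "sqrt (real (Suc k)) \<le> 2 * sqrt (ln \<bar>\<xi>\<bar>)"
        by (simp add: real_sqrt_mult)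
      \<comment> \<open>The negative exponent calls for the upper bound \<open>2 ^ Suc k\<close> on
        \<open>\<bar>\<xi>\<bar>\<close>; the extra factor \<open>q\<close> is undone by
        \<open>q > 1/2\<close>.\<close>
      have "q ^ Suc k = (2 ^ Suc k) powr (- \<alpha> / 2)"
      proof -
        have "(2 :: real) ^ Suc k = 2 powr real (Suc k)"
          by (rule powr_realpow[symmetric]) simp
        moreover have "q ^ Suc k = 2 powr (real (Suc k) * (- \<alpha> / 2))"
          unfolding q_def by (rule powr_power) simp
        ultimately show ?thesis
          by (simp only: powr_powr)
      qed
      also have "\<dots> \<le> \<bar>\<xi>\<bar> powr (- \<alpha> / 2)"
        using k \<xi> \<alpha> by (intro powr_mono2') auto
      finally have "q * q ^ k \<le> \<bar>\<xi>\<bar> powr (- \<alpha> / 2)"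
        by simp
      moreover have "1 / 2 * q ^ k \<le> q * q ^ k"
        using q by (intro mult_right_mono) auto
      ultimately show "q ^ k \<le> 2 * \<bar>\<xi>\<bar> powr (- \<alpha> / 2)"
        by simp
    qed (use \<open>0 \<le> D\<close> q \<xi> in auto)
    also have "\<dots> = ((1 + 32 * D) * 4) * \<bar>\<xi>\<bar> powr (- \<alpha> / 2) * (ln \<bar>\<xi>\<bar>) powr (1 / 2)"
      using \<xi> by (simp add: powr_half_sqrt)
    finally show ?thesis .
  qed
  then show ?thesis
    by blast
qed

end

theorem theorem2:
  fixes \<alpha> :: real
  assumes "0 < \<alpha>" and "\<alpha> < 1"
  shows "\<exists>(E :: real set) (\<mu> :: real measure) (c :: real) (C :: real).
    compact E \<and> real_distribution \<mu> \<and> measure \<mu> E = 1 \<and> 0 < c \<and> c \<le> C \<and>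
    (\<forall>\<xi> :: real. \<bar>\<xi>\<bar> \<ge> 2 \<longrightarrow>
      cmod (fourier_measure \<mu> \<xi>) \<le> C * \<bar>\<xi>\<bar> powr (- \<alpha> / 2) * (ln \<bar>\<xi>\<bar>) powr (1 / 2)) \<and>
    (\<forall>I :: real set. is_interval I \<and> bounded I \<and> I \<noteq> {} \<and> centered_in I E \<and> interval_length I < 1 \<longrightarrow>
      c * interval_length I powr \<alpha> \<le> measure \<mu> I \<and> measure \<mu> I \<le> C * interval_length I powr \<alpha>)"
proof -
  obtain M a where "dyadic_cantor \<alpha> M a"
    using exists_dyadic_cantor[OF assms] by blast
  then interpret dyadic_cantor \<alpha> M a .
  obtain D where D: "\<And>\<xi>. 2 \<le> \<bar>\<xi>\<bar> \<Longrightarrow>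
    cmod (fourier_measure cantor_measure \<xi>) \<le> D * \<bar>\<xi>\<bar> powr (- \<alpha> / 2) * (ln \<bar>\<xi>\<bar>) powr (1 / 2)"
    using exists_fourier_decay_constant by blast
  \<comment> \<open>One constant serves decay and regularity; being at least 12 it also exceeds the
    lower constant \<open>1/8\<close>.\<close>
  define C where "C = max D 12"
  have "cmod (fourier_measure cantor_measure \<xi>) \<le> C * \<bar>\<xi>\<bar> powr (- \<alpha> / 2) * (ln \<bar>\<xi>\<bar>) powr (1 / 2)"
    if "2 \<le> \<bar>\<xi>\<bar>" for \<xi>
    using D[OF that] by (rule order_trans) (intro mult_right_mono, auto simp: C_def)
  moreover have "measure cantor_measure I \<le> C * interval_length I powr \<alpha>"
    if "bounded I" "I \<noteq> {}" "interval_length I < 1" for I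
    using measure_interval_le[OF that] by (rule order_trans) (intro mult_right_mono, auto simp: C_def)
  ultimately show ?thesis
    using compact_cantor_set real_distribution_cantor_measure measure_cantor_set measure_interval_ge
    by (intro exI[of _ cantor_set] exI[of _ cantor_measure] exI[of _ "1 / 8"] exI[of _ C])
      (auto simp: C_def)
qed

end
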